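(* Let $\hat{\mathcal{U}}_n\subseteq\mathbb{R}^{m_1}$ and $\hat{\mathcal{V}}_n\subseteq\mathbb{R}^{m_2}$ be $R$-dimensional linear subspaces and let $\mathbf{A}_1,\dots,\mathbf{A}_n\in\mathbb{R}^{m_1\times m_2}$ be the previously observed masks. The optimal sequential mask $$\mathbf{A}_{n+1}^*=\underset{\|\mathbf{A}\|_F^2\le 1}{\mathrm{argmax}}\ \left\{\|\mathcal{P}_{\hat{\mathcal{U}}_n}\mathbf{A}\mathcal{P}_{\hat{\mathcal{V}}_n}\|_F^2-\hat{\mathbf{r}}_n^T(\mathbf{A})\,[\hat{\mathbf{R}}_n(\mathbf{A}_{1:n})+\gamma^2\mathbf{I}]^{-1}\,\hat{\mathbf{r}}_n(\mathbf{A})\right\}$$ (over $\mathbf{A}\in\mathbb{R}^{m_1\times m_2}$) takes the form $$\mathbf{A}_{n+1}^*=\mathbf{U}\boldsymbol{\Sigma}^*\mathbf{V}^T,$$ for any $\mathbf{U}\in\mathbb{R}^{m_1\times R}$ with columns in $\hat{\mathcal{U}}_n$ and $\mathbf{U}^T\mathbf{U}=\mathbf{I}$, and any $\mathbf{V}\in\mathbb{R}^{m_2\times R}$ with columns in $\hat{\mathcal{V}}_n$ and $\mathbf{V}^T\mathbf{V}=\mathbf{I}$. Here $\mathrm{vec}(\boldsymbol{\Sigma}^* )\in\mathbb{R}^{R^2}$ is the unit eigenvector for the smallest eigenvalue of $\mathbf{D}^T[\hat{\mathbf{R}}_n(\mathbf{A}_{1:n})+\gamma^2\mathbf{I}]^{-1}\mathbf{D}$,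 where $\mathbf{D}=[\mathrm{vec}(\boldsymbol{\Sigma}_1)^T;\cdots;\mathrm{vec}(\boldsymbol{\Sigma}_n)^T]\in\mathbb{R}^{n\times R^2}$ is the matrix with $i$-th row $\mathrm{vec}(\boldsymbol{\Sigma}_i)^T$, and $\boldsymbol{\Sigma}_i=\mathbf{U}^T\mathbf{A}_i\mathbf{V}$.
   Context: $\mathcal{P}_{\hat{\mathcal{U}}_n}$ and $\mathcal{P}_{\hat{\mathcal{V}}_n}$ are the orthogonal projection matrices onto $\hat{\mathcal{U}}_n$ and $\hat{\mathcal{V}}_n$ (current estimates of the row and column spaces of an unknown low-rank matrix $\mathbf{X}$); $\langle\mathbf{A},\mathbf{B}\rangle_F=\mathrm{tr}(\mathbf{A}^T\mathbf{B})$ is the Frobenius inner product with norm $\|\cdot\|_F$; $\mathrm{vec}(\cdot)$ is vectorization; $R<\min(m_1,m_2)$; $\mathbf{A}_{1:n}=[\mathbf{A}_1\ \cdots\ \mathbf{A}_n]$, with all masks satisfying the unit power constraint $\|\mathbf{A}_i\|_F^2\le1$; and $\gamma^2=\eta^2/\sigma^2$ is the ratio of the measurement noise variance $\eta^2$ to the signal variance parameter $\sigma^2$. Further, $$\hat{\mathbf{R}}_n(\mathbf{A}_{1:n})=\left[\langle\mathcal{P}_{\hat{\mathcal{U}}_n}\mathbf{A}_i\mathcal{P}_{\hat{\mathcal{V}}_n},\mathcal{P}_{\hat{\mathcal{U}}_n}\mathbf{A}_j\mathcal{P}_{\hat{\mathcal{V}}_n}\rangle_F\right]_{i,j=1}^n\in\mathbb{R}^{n\times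 n},\qquad \hat{\mathbf{r}}_n(\mathbf{A})=\left[\langle\mathcal{P}_{\hat{\mathcal{U}}_n}\mathbf{A}_i\mathcal{P}_{\hat{\mathcal{V}}_n},\mathcal{P}_{\hat{\mathcal{U}}_n}\mathbf{A}\mathcal{P}_{\hat{\mathcal{V}}_n}\rangle_F\right]_{i=1}^n\in\mathbb{R}^n.$$ *)

theory Defs
  imports "HOL-Analysis.Analysis"
begin

definition frob_inner :: "real^'n^'m \<Rightarrow> real^'n^'m \<Rightarrow> real" where
  "frob_inner A B = trace (transpose A ** B)"

definition frob_norm :: "real^'n^'m \<Rightarrow> real" where
  "frob_norm A = sqrt (frob_inner A A)"

text \<open>For a subspace \<open>S\<close>, the matrix described here exists and is unique; see
  \<open>orth_proj_matrix_works\<close> and \<open>orth_proj_matrix_unique\<close> below.\<close>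

definition orth_proj_matrix :: "(real^'m) set \<Rightarrow> real^'m^'m" where
  "orth_proj_matrix S =
     (THE P. \<forall>x. P *v x \<in> S \<and> (\<forall>s\<in>S. orthogonal (x - P *v x) s))"

lemma orth_proj_matrix_unique:
  fixes P Q :: "real^'m^'m"
  assumes S: "subspace S"
    and P: "\<forall>x. P *v x \<in> S \<and> (\<forall>s\<in>S. orthogonal (x - P *v x) s)"
    and Q: "\<forall>x. Q *v x \<in> S \<and> (\<forall>s\<in>S. orthogonal (x - Q *v x) s)"
  shows "P = Q"
proof -
  have "P *v x = Q *v x" for x
  proof -
    have d: "P *v x - Q *v x \<in> S"
      using P Q S by (simp add: subspace_diff)
    have "(x - P *v x) \<bullet> (P *v x - Q *v x) = 0" "(x - Q *v x) \<bullet> (P *v x - Q *v x) = 0"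
      using P Q d by (auto simp: orthogonal_def)
    then have "(P *v x - Q *v x) \<bullet> (P *v x - Q *v x) = 0"
      by (simp add: algebra_simps)
    then show ?thesis by simp
  qed
  then show ?thesis by (simp add: matrix_eq)
qed

lemma orth_proj_matrix_works:
  fixes S :: "(real^'m) set"
  assumes S: "subspace S"
  shows "orth_proj_matrix S *v x \<in> S \<and> (\<forall>s\<in>S. orthogonal (x - orth_proj_matrix S *v x) s)"
proof -
  have "\<exists>y. y \<in> S \<and> (\<forall>s\<in>S. orthogonal (x - y) s)" for x
  proof -
    obtain y z where "y \<in> span S" "\<And>w. w \<in> span S \<Longrightarrow> orthogonal z w" "x = y + z"
      using orthogonal_subspace_decomp_exists[of S x] by blast
    then show ?thesis using S by (intro exI[of _ y]) (metis add_diff_cancel_left' span_eq_iff)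
  qed
  then obtain p where p: "\<And>x. p x \<in> S" "\<And>x s. s \<in> S \<Longrightarrow> orthogonal (x - p x) s"
    by metis
  have uniq: "p x = y" if y: "y \<in> S" "\<And>s. s \<in> S \<Longrightarrow> orthogonal (x - y) s" for x y
  proof -
    have d: "p x - y \<in> S" using p(1) y(1) S by (simp add: subspace_diff)
    have "(x - p x) \<bullet> (p x - y) = 0" "(x - y) \<bullet> (p x - y) = 0"
      using p(2) y(2) d by (auto simp: orthogonal_def)
    then have "(p x - y) \<bullet> (p x - y) = 0" by (simp add: algebra_simps)
    then show ?thesis by simp
  qed
  have lin: "linear p"
  proof
    fix x y :: "real^'m" and c :: real
    show "p (x + y) = p x + p y"
    proof (rule uniq)
      show "p x + p y \<in> S" using p(1) S by (simp add: subspace_add)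
      fix s assume "s \<in> S"
      with p(2)[of s x] p(2)[of s y] show "orthogonal (x + y - (p x + p y)) s"
        by (simp add: orthogonal_def algebra_simps)
    qed
    show "p (c *\<^sub>R x) = c *\<^sub>R p x"
    proof (rule uniq)
      show "c *\<^sub>R p x \<in> S" using p(1) S by (simp add: subspace_scale)
      fix s assume "s \<in> S"
      with p(2)[of s x] show "orthogonal (c *\<^sub>R x - c *\<^sub>R p x) s"
        by (simp add: orthogonal_def flip: scaleR_diff_right)
    qed
  qed
  have "\<forall>x. matrix p *v x \<in> S \<and> (\<forall>s\<in>S. orthogonal (x - matrix p *v x) s)"
    using p lin by (simp add: matrix_works)
  then have "\<exists>!P :: real^'m^'m. \<forall>x. P *v x \<in> S \<and> (\<forall>s\<in>S. orthogonal (x - P *v x) s)"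
    using orth_proj_matrix_unique[OF S] by (intro ex1I[of _ "matrix p"]) blast+
  from theI'[OF this] show ?thesis
    unfolding orth_proj_matrix_def by blast
qed

text \<open>Column stacking: the entries of the vectorization are indexed by pairs (column, row), so a
  matrix with index types \<open>'r\<close> gives a vector with \<open>CARD('r)\<^sup>2\<close> entries.\<close>

definition vectorize :: "real^'c^'r \<Rightarrow> real^('c \<times> 'r)" where
  "vectorize A = (\<chi> p. A $ snd p $ fst p)"

definition eigenvector :: "real^'k^'k \<Rightarrow> real^'k \<Rightarrow> real \<Rightarrow> bool" where
  "eigenvector M v l \<longleftrightarrow> v \<noteq> 0 \<and> M *v v = l *\<^sub>R v"

definition eigenvalue :: "real^'k^'k \<Rightarrow> real \<Rightarrow> bool" where
  "eigenvalue M l \<longleftrightarrow> (\<exists>v. eigenvector M v l)"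

definition smallest_eigenvalue :: "real^'k^'k \<Rightarrow> real \<Rightarrow> bool" where
  "smallest_eigenvalue M l \<longleftrightarrow> eigenvalue M l \<and> (\<forall>l'. eigenvalue M l' \<longrightarrow> l \<le> l')"

text \<open>Below, the masks \<open>A\<^sub>1, \<dots>, A\<^sub>n\<close> form a family indexed by a finite type \<open>'n\<close> with
  \<open>n = CARD('n)\<close>.\<close>

definition proj_mask ::
  "(real^'m1) set \<Rightarrow> (real^'m2) set \<Rightarrow> real^'m2^'m1 \<Rightarrow> real^'m2^'m1" where
  "proj_mask \<U> \<V> A = orth_proj_matrix \<U> ** A ** orth_proj_matrix \<V>"

definition R_hat ::
  "(real^'m1) set \<Rightarrow> (real^'m2) set \<Rightarrow> ('n::finite \<Rightarrow> real^'m2^'m1) \<Rightarrow> real^'n^'n" where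
  "R_hat \<U> \<V> As = (\<chi> i j. frob_inner (proj_mask \<U> \<V> (As i)) (proj_mask \<U> \<V> (As j)))"

definition r_hat ::
  "(real^'m1) set \<Rightarrow> (real^'m2) set \<Rightarrow> ('n::finite \<Rightarrow> real^'m2^'m1) \<Rightarrow> real^'m2^'m1 \<Rightarrow> real^'n" where
  "r_hat \<U> \<V> As A = (\<chi> i. frob_inner (proj_mask \<U> \<V> (As i)) (proj_mask \<U> \<V> A))"

definition mask_objective ::
  "(real^'m1) set \<Rightarrow> (real^'m2) set \<Rightarrow> real \<Rightarrow> ('n::finite \<Rightarrow> real^'m2^'m1) \<Rightarrow> real^'m2^'m1 \<Rightarrow> real" where
  "mask_objective \<U> \<V> \<gamma> As A =
     (frob_norm (proj_mask \<U> \<V> A))\<^sup>2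
     - r_hat \<U> \<V> As A
         \<bullet> (matrix_inv (R_hat \<U> \<V> As + \<gamma>\<^sup>2 *\<^sub>R mat 1) *v r_hat \<U> \<V> As A)"

definition optimal_mask ::
  "(real^'m1) set \<Rightarrow> (real^'m2) set \<Rightarrow> real \<Rightarrow> ('n::finite \<Rightarrow> real^'m2^'m1) \<Rightarrow> real^'m2^'m1 \<Rightarrow> bool" where
  "optimal_mask \<U> \<V> \<gamma> As =
     is_arg_max (mask_objective \<U> \<V> \<gamma> As) (\<lambda>A. (frob_norm A)\<^sup>2 \<le> 1)"

definition D_matrix ::
  "real^'r^'m1 \<Rightarrow> real^'r^'m2 \<Rightarrow> ('n::finite \<Rightarrow> real^'m2^'m1) \<Rightarrow> real^('r \<times> 'r)^'n" where
  "D_matrix U V As = (\<chi> i. vectorize (transpose U ** As i ** V))"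

end

theory Submission
  imports Defs
begin

text \<open>Both orthogonal projections factor as \<open>U U\<^sup>T\<close> and \<open>V V\<^sup>T\<close>, so the objective at \<open>A\<close> depends
  only on \<open>d = vec (U\<^sup>T A V)\<close> and equals \<open>d \<bullet> d - d \<bullet> M d\<close> with
  \<open>M = D\<^sup>T (D D\<^sup>T + \<gamma>\<^sup>2 I)\<^sup>-\<^sup>1 D\<close>. Since \<open>\<gamma>\<^sup>2 > 0\<close> this form is positive definite, which forces
  a maximizer to have \<open>\<parallel>d\<parallel> = 1 = \<parallel>A\<parallel>\<close>. By Pythagoras \<open>\<parallel>A\<parallel> = \<parallel>d\<parallel>\<close> holds only for
  \<open>A = U (U\<^sup>T A V) V\<^sup>T\<close>, and then \<open>d\<close> minimizes the Rayleigh quotient of \<open>M\<close>.\<close>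

section \<open>Quadratic forms, Rayleigh quotients and smallest eigenvalues of symmetric
  matrices\<close>

lemma inner_matrix_vector_transpose:
  fixes A :: "real^'n^'m"
  shows "(A *v x) \<bullet> y = x \<bullet> (transpose A *v y)"
  by (metis dot_lmul_matrix inner_commute transpose_matrix_vector transpose_transpose)

text \<open>If \<open>N *v v\<close> were nonzero, a small step from \<open>v\<close> against
  \<open>w = N *v v\<close> would make the form negative: along \<open>v + t *\<^sub>R w\<close> its
  linear term is \<open>2 * t * a\<close> with \<open>a > 0\<close>.\<close>

lemma psd_quadratic_form_zero:
  fixes N :: "real^'k^'k"
  assumes sym: "transpose N = N" and psd: "\<And>x. x \<bullet> (N *v x) \<ge> 0" and zero: "v \<bullet> (N *v v) = 0"
  shows "N *v v = 0"
proof (rule ccontr)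
  define w where "w = N *v v"
  define a where "a = w \<bullet> w"
  define b where "b = w \<bullet> (N *v w)"
  assume "N *v v \<noteq> 0"
  then have a: "a > 0" by (simp add: a_def w_def)
  have b: "b \<ge> 0" using psd by (simp add: b_def)
  have vw: "v \<bullet> (N *v w) = a"
    using inner_matrix_vector_transpose[of N v w] sym by (simp add: a_def w_def)
  have q: "2 * t * a + t\<^sup>2 * b \<ge> 0" for t
  proof -
    have "(v + t *\<^sub>R w) \<bullet> (N *v (v + t *\<^sub>R w)) = 2 * t * a + t\<^sup>2 * b"
      using zero vw
      by (simp add: matrix_vector_right_distrib matrix_vector_mult_scaleR inner_left_distrib
          inner_right_distrib power2_eq_square a_def b_def distrib_left flip: w_def)
    then show ?thesis using psd by metis
  qed
  \<comment> \<open>The form along the line is \<open>2 * t * a + t\<^sup>2 * b\<close>. Its minimum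
    would be at \<open>t = - a / b\<close>; the \<open>+ 1\<close> covers \<open>b = 0\<close> and
    still leaves a negative value at \<open>t = - s\<close>.\<close>
  define s where "s = a / (b + 1)"
  have s: "s > 0" "a = s * (b + 1)" using a b by (simp_all add: s_def)
  have "2 * (- s) * a + (- s)\<^sup>2 * b = - (s\<^sup>2 * (b + 2))"
    unfolding s(2) by (simp add: algebra_simps power2_eq_square)
  moreover have "s\<^sup>2 * (b + 2) > 0" using s(1) b by simp
  ultimately show False using q[of "- s"] by linarith
qed

text \<open>The shifted matrix \<open>M - l *\<^sub>R mat 1\<close> is positive semidefinite by
  \<open>low\<close>, and its form vanishes at \<open>v\<close> by \<open>eq\<close>, so it
  annihilates \<open>v\<close>.\<close>

lemma rayleigh_minimizer_eigenvector:
  fixes M :: "real^'k^'k"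
  assumes sym: "transpose M = M" and low: "\<And>x. l * (x \<bullet> x) \<le> x \<bullet> (M *v x)"
    and eq: "v \<bullet> (M *v v) = l * (v \<bullet> v)"
  shows "M *v v = l *\<^sub>R v"
proof -
  have N: "(M - l *\<^sub>R mat 1) *v x = M *v x - l *\<^sub>R x" for x
    by (simp add: matrix_vector_mult_diff_rdistrib scaleR_matrix_vector_assoc[symmetric])
  have "(M - l *\<^sub>R mat 1) *v v = 0"
  proof (rule psd_quadratic_form_zero)
    have "transpose (mat 1 :: real^'k^'k) = mat 1" by simp
    then show "transpose (M - l *\<^sub>R mat 1) = M - l *\<^sub>R mat 1"
      using sym by (simp add: transpose_def vec_eq_iff)
  qed (use low eq in \<open>auto simp: N inner_diff_right\<close>)
  then show ?thesis by (simp add: N)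
qed

text \<open>The form attains its minimum on the compact unit sphere; homogeneity of degree two
  carries the bound to every vector.\<close>

lemma rayleigh_minimizer_exists:
  fixes M :: "real^'k^'k"
  obtains v where "norm v = 1" "\<And>x. (v \<bullet> (M *v v)) * (x \<bullet> x) \<le> x \<bullet> (M *v x)"
proof -
  have ne: "sphere (0::real^'k) 1 \<noteq> {}"
    by (metis empty_iff mem_sphere_0 vector_choose_size zero_le_one)
  have cont: "continuous_on (sphere 0 1) (\<lambda>x. x \<bullet> (M *v x))"
    by (intro continuous_intros linear_continuous_on) (simp add: linear_linear)
  obtain v where v: "v \<in> sphere 0 1" "\<And>x. x \<in> sphere 0 1 \<Longrightarrow> v \<bullet> (M *v v) \<le> x \<bullet> (M *v x)"
    using continuous_attains_inf[OF compact_sphere ne cont] by blast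
  have "(v \<bullet> (M *v v)) * (x \<bullet> x) \<le> x \<bullet> (M *v x)" for x
  proof (cases "x = 0")
    case False
    define u where "u = (1 / norm x) *\<^sub>R x"
    have x: "x = norm x *\<^sub>R u" using False by (simp add: u_def)
    have "v \<bullet> (M *v v) \<le> u \<bullet> (M *v u)" using False by (intro v(2)) (simp add: u_def)
    then have "(norm x)\<^sup>2 * (v \<bullet> (M *v v)) \<le> (norm x)\<^sup>2 * (u \<bullet> (M *v u))"
      by (simp add: mult_left_mono)
    also have "\<dots> = x \<bullet> (M *v x)"
      by (subst (2 3) x) (simp add: matrix_vector_mult_scaleR power2_eq_square)
    finally show ?thesis by (simp add: power2_norm_eq_inner mult.commute)
  qed simp
  with v(1) show ?thesis by (intro that[of v]) auto
qed

text \<open>This is the bridge between the spectral condition in the theorem and the variational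
  condition that maximality of a mask yields.\<close>

lemma smallest_eigenvalue_rayleigh:
  fixes M :: "real^'k^'k"
  assumes sym: "transpose M = M" and v: "norm v = 1"
  shows "(smallest_eigenvalue M l \<and> eigenvector M v l) \<longleftrightarrow>
    v \<bullet> (M *v v) = l \<and> (\<forall>x. l * (x \<bullet> x) \<le> x \<bullet> (M *v x))"
proof
  have v1: "v \<bullet> v = 1" using v by (simp add: norm_eq_1)
  assume *: "smallest_eigenvalue M l \<and> eigenvector M v l"
  \<comment> \<open>A minimizer \<open>w\<close> is itself an eigenvector, so its Rayleigh value is
    an eigenvalue and hence at least \<open>l\<close>; its lower bound then passes to
    \<open>l\<close>.\<close>
  obtain w where w: "norm w = 1" "\<And>x. (w \<bullet> (M *v w)) * (x \<bullet> x) \<le> x \<bullet> (M *v x)"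
    using rayleigh_minimizer_exists by blast
  have "w \<bullet> w = 1" "w \<noteq> 0" using w(1) by (auto simp: norm_eq_1)
  then have "eigenvalue M (w \<bullet> (M *v w))"
    using rayleigh_minimizer_eigenvector[OF sym w(2), of w]
    by (auto simp: eigenvalue_def eigenvector_def)
  then have "l \<le> w \<bullet> (M *v w)" using * by (simp add: smallest_eigenvalue_def)
  then have "l * (x \<bullet> x) \<le> x \<bullet> (M *v x)" for x
    using w(2)[of x] by (meson inner_ge_zero mult_right_mono order_trans)
  then show "v \<bullet> (M *v v) = l \<and> (\<forall>x. l * (x \<bullet> x) \<le> x \<bullet> (M *v x))"
    using * v1 by (simp add: eigenvector_def)
next
  have v1: "v \<bullet> v = 1" "v \<noteq> 0" using v by (auto simp: norm_eq_1)
  assume *: "v \<bullet> (M *v v) = l \<and> (\<forall>x. l * (x \<bullet> x) \<le> x \<bullet> (M *v x))"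
  then have "eigenvector M v l"
    using rayleigh_minimizer_eigenvector[OF sym, of l v] v1 by (simp add: eigenvector_def)
  moreover have "l \<le> l'" if "eigenvector M x l'" for x l'
  proof -
    have "x \<noteq> 0" "M *v x = l' *\<^sub>R x" using that by (auto simp: eigenvector_def)
    then have "l * (x \<bullet> x) \<le> l' * (x \<bullet> x)" "x \<bullet> x > 0" using * by (metis inner_scaleR_right, simp)
    then show ?thesis by simp
  qed
  ultimately show "smallest_eigenvalue M l \<and> eigenvector M v l"
    by (auto simp: smallest_eigenvalue_def eigenvalue_def)
qed

section \<open>The regularized Gram matrix and the quadratic form built from its inverse\<close>

lemma mat_add_scaled_vector:
  fixes Q :: "real^'n^'n"
  shows "(Q + c *\<^sub>R mat 1) *v y = Q *v y + c *\<^sub>R y"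
  by (simp add: matrix_vector_mult_add_rdistrib scaleR_matrix_vector_assoc[symmetric])

lemma regularized_gram_inner:
  fixes D :: "real^'k^'n"
  shows "y \<bullet> ((D ** transpose D + c *\<^sub>R mat 1) *v y) = (norm (transpose D *v y))\<^sup>2 + c * (norm y)\<^sup>2"
  using inner_matrix_vector_transpose[of D "transpose D *v y" y]
  by (simp add: mat_add_scaled_vector inner_right_distrib power2_norm_eq_inner inner_commute
      flip: matrix_vector_mul_assoc)

text \<open>The term \<open>c * (norm y)\<^sup>2\<close> makes the matrix positive definite, so its
  kernel is trivial.\<close>

lemma regularized_gram_invertible:
  fixes D :: "real^'k^'n"
  assumes "c > 0"
  shows "invertible (D ** transpose D + c *\<^sub>R mat 1)"
proof -
  have "y = 0" if "(D ** transpose D + c *\<^sub>R mat 1) *v y = 0" for y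
  proof -
    have "(norm (transpose D *v y))\<^sup>2 + c * (norm y)\<^sup>2 = 0"
      using that regularized_gram_inner[of y D c] by simp
    then have "c * (norm y)\<^sup>2 \<le> 0"
      by (smt (verit) zero_le_power2)
    then show ?thesis using assms by (simp add: mult_le_0_iff)
  qed
  then show ?thesis
    by (simp add: invertible_left_inverse matrix_left_invertible_ker)
qed

lemma matrix_inv_right:
  fixes Q :: "real^'n^'n"
  assumes "invertible Q"
  shows "Q ** matrix_inv Q = mat 1"
  using someI_ex[OF assms[unfolded invertible_def]] by (simp add: matrix_inv_def)

text \<open>Transposing \<open>Q ** matrix_inv Q = mat 1\<close> gives a left inverse of
  \<open>transpose Q\<close>, which must agree with its right inverse.\<close>

lemma transpose_matrix_inv:
  fixes Q :: "real^'n^'n"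
  assumes "invertible Q"
  shows "transpose (matrix_inv Q) = matrix_inv (transpose Q)"
proof -
  have "transpose (matrix_inv Q) ** transpose Q = transpose (mat 1)"
    by (simp only: matrix_inv_right[OF assms] flip: matrix_transpose_mul)
  then have "transpose (matrix_inv Q) ** transpose Q = mat 1" by simp
  moreover have "transpose Q ** matrix_inv (transpose Q) = mat 1"
    by (rule matrix_inv_right[OF transpose_invertible[OF assms]])
  ultimately show ?thesis by (metis matrix_mul_assoc matrix_mul_lid matrix_mul_rid)
qed

lemma ridge_matrix_symmetric:
  fixes D :: "real^'k^'n"
  assumes "c > 0"
  defines "Q \<equiv> D ** transpose D + c *\<^sub>R mat 1"
  shows "transpose (transpose D ** matrix_inv Q ** D) = transpose D ** matrix_inv Q ** D"
proof -
  have "transpose (D ** transpose D) = D ** transpose D" by (simp add: matrix_transpose_mul)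
  moreover have "transpose (mat 1 :: real^'n^'n) = mat 1" by simp
  ultimately have "transpose Q = Q"
    by (simp add: Q_def transpose_def vec_eq_iff)
  then show ?thesis
    using transpose_matrix_inv[of Q] regularized_gram_invertible[OF assms(1), of D]
    by (simp add: Q_def matrix_transpose_mul matrix_mul_assoc)
qed

lemma ridge_quadratic_form:
  fixes D :: "real^'k^'n"
  shows "x \<bullet> ((transpose D ** Q ** D) *v x) = (D *v x) \<bullet> (Q *v (D *v x))"
  by (simp add: inner_matrix_vector_transpose matrix_vector_mul_assoc matrix_mul_assoc)

text \<open>With \<open>y = matrix_inv Q *v (D *v x)\<close> the form is
  \<open>(D *v x) \<bullet> y\<close>. It exceeds \<open>(norm (transpose D *v y))\<^sup>2\<close>
  by \<open>c * (norm y)\<^sup>2\<close>, yet Cauchy-Schwarz bounds it by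
  \<open>norm x * norm (transpose D *v y)\<close>; together these force strictness.\<close>

lemma ridge_quadratic_form_less:
  fixes D :: "real^'k^'n"
  assumes c: "c > 0" and x: "x \<noteq> 0"
  defines "Q \<equiv> D ** transpose D + c *\<^sub>R mat 1"
  shows "x \<bullet> ((transpose D ** matrix_inv Q ** D) *v x) < x \<bullet> x"
proof -
  define y where "y = matrix_inv Q *v (D *v x)"
  have "Q *v y = D *v x"
    using regularized_gram_invertible[OF c, of D]
    by (simp add: y_def Q_def matrix_vector_mul_assoc matrix_mul_assoc matrix_inv_right)
  then have e: "(D *v x) \<bullet> y = (norm (transpose D *v y))\<^sup>2 + c * (norm y)\<^sup>2"
    using regularized_gram_inner[of y D c] by (simp add: Q_def inner_commute)
  have cs: "(D *v x) \<bullet> y \<le> norm x * norm (transpose D *v y)"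
    by (simp add: inner_matrix_vector_transpose norm_cauchy_schwarz)
  have "(D *v x) \<bullet> y < (norm x)\<^sup>2"
  proof (cases "y = 0")
    case False
    define a where "a = norm (transpose D *v y)"
    \<comment> \<open>The positive regularization term makes \<open>a * a < norm x * a\<close>
      strict, so a factor \<open>a\<close> can be cancelled.\<close>
    have "c * (norm y)\<^sup>2 > 0" using False c by simp
    then have "a * a < norm x * a" using e cs by (simp add: a_def power2_eq_square)
    then have "a < norm x"
      by (simp add: a_def mult_less_cancel_right)
    then have "norm x * a < norm x * norm x" using x by simp
    then show ?thesis using cs by (simp add: a_def power2_eq_square)
  qed (use x in simp)
  then show ?thesis
    by (simp add: ridge_quadratic_form y_def power2_norm_eq_inner)
qed

section \<open>Vectorization and the Frobenius inner product as Euclidean structures\<close>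

lemma vectorize_inner: "vectorize A \<bullet> vectorize B = A \<bullet> B"
proof -
  have "vectorize A \<bullet> vectorize B = (\<Sum>p\<in>UNIV \<times> UNIV. A $ snd p $ fst p * B $ snd p $ fst p)"
    by (simp add: vectorize_def inner_vec_def UNIV_Times_UNIV)
  also have "\<dots> = (\<Sum>j\<in>UNIV. \<Sum>i\<in>UNIV. A $ i $ j * B $ i $ j)"
    by (simp add: sum.cartesian_product case_prod_unfold)
  also have "\<dots> = A \<bullet> B"
    by (subst sum.swap) (simp add: inner_vec_def)
  finally show ?thesis .
qed

lemma norm_vectorize: "norm (vectorize A) = norm A"
  by (simp add: norm_eq_sqrt_inner vectorize_inner)

lemma vectorize_surj: "\<exists>A. vectorize A = v"
  by (rule exI[of _ "\<chi> i j. v $ (j, i)"]) (simp add: vectorize_def vec_eq_iff)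

lemma frob_inner_eq: "frob_inner A B = A \<bullet> B"
  unfolding frob_inner_def trace_def inner_vec_def matrix_matrix_mult_def transpose_def
  by (simp, subst sum.swap, simp)

lemma frob_norm_eq: "frob_norm A = norm A"
  by (simp add: frob_norm_def frob_inner_eq norm_eq_sqrt_inner)

section \<open>Compression of a matrix by factors with orthonormal columns\<close>

lemma inner_sandwich:
  fixes X :: "real^'s^'r" and U :: "real^'r^'m1" and V :: "real^'s^'m2"
  shows "(U ** X ** transpose V) \<bullet> A = X \<bullet> (transpose U ** A ** V)"
proof -
  \<comment> \<open>Cyclicity of the trace moves \<open>V\<close> to the other end; thus
    \<open>X \<mapsto> U ** X ** transpose V\<close> is adjoint to the compression
    \<open>A \<mapsto> transpose U ** A ** V\<close>.\<close>
  have "trace (transpose (U ** X ** transpose V) ** A) = trace (V ** (transpose X ** transpose U ** A))"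
    by (simp add: matrix_transpose_mul matrix_mul_assoc)
  also have "\<dots> = trace (transpose X ** transpose U ** A ** V)"
    by (rule trace_mul_sym)
  finally show ?thesis
    by (simp add: frob_inner_def matrix_mul_assoc flip: frob_inner_eq)
qed

lemma orthonormal_sandwich_cancel:
  fixes X :: "real^'s^'r" and U :: "real^'r^'m1" and V :: "real^'s^'m2"
  assumes "transpose U ** U = mat 1" "transpose V ** V = mat 1"
  shows "transpose U ** (U ** X ** transpose V) ** V = X"
proof -
  have "transpose U ** (U ** X ** transpose V) ** V
      = (transpose U ** U) ** X ** (transpose V ** V)"
    by (simp only: matrix_mul_assoc)
  then show ?thesis by (simp add: assms)
qed

text \<open>Pythagoras: adjointness makes the residual orthogonal to
  \<open>U ** X ** transpose V\<close>, which has the same norm as \<open>X\<close>.\<close>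

lemma norm_orthonormal_compression:
  fixes U :: "real^'r^'m1" and V :: "real^'s^'m2" and A :: "real^'m2^'m1"
  assumes "transpose U ** U = mat 1" "transpose V ** V = mat 1"
  defines "X \<equiv> transpose U ** A ** V"
  shows "(norm A)\<^sup>2 = (norm X)\<^sup>2 + (norm (A - U ** X ** transpose V))\<^sup>2"
proof -
  define B where "B = U ** X ** transpose V"
  have "B \<bullet> A = X \<bullet> X" unfolding B_def X_def by (rule inner_sandwich)
  moreover have "B \<bullet> B = X \<bullet> X" unfolding B_def
    by (simp only: inner_sandwich orthonormal_sandwich_cancel[OF assms(1,2)])
  ultimately show ?thesis
    unfolding B_def[symmetric] power2_norm_eq_inner
    by (simp add: inner_diff_left inner_diff_right inner_commute)
qed

section \<open>Orthonormal bases of a subspace and its orthogonal projection\<close>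

lemma orthonormal_columns_range:
  fixes U :: "real^'r^'m"
  assumes S: "subspace S" "dim S = CARD('r)"
    and U: "columns U \<subseteq> S" "transpose U ** U = mat 1"
  shows "range ((*v) U) = S"
proof (rule subspace_dim_equal)
  have inj: "inj ((*v) U)"
    using U(2) matrix_left_invertible_injective by blast
  show "subspace (range ((*v) U))"
    by (simp add: linear_subspace_image linear_linear)
  show "range ((*v) U) \<subseteq> S"
  proof clarify
    fix x
    have "U *v x = (\<Sum>i\<in>UNIV. x $ i *\<^sub>R column i U)"
      by (simp add: matrix_mult_sum scalar_mult_eq_scaleR)
    also have "\<dots> \<in> S"
      using U(1) S(1) by (auto simp: columns_def intro!: subspace_sum subspace_scale)
    finally show "U *v x \<in> S" .
  qed
  \<comment> \<open>Injectivity makes the range \<open>CARD('r)\<close>-dimensional, so its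
    inclusion in \<open>S\<close> is an equality.\<close>
  have "dim (range ((*v) U)) = dim (UNIV :: (real^'r) set)"
    by (rule dim_image_eq) (use inj in \<open>auto intro: inj_on_subset\<close>)
  then show "dim S \<le> dim (range ((*v) U))" using S(2) by simp
qed (fact S(1))

text \<open>\<open>U ** transpose U\<close> satisfies the characterization of the projection: every
  element of \<open>S\<close> is some \<open>U *v w\<close>, and
  \<open>transpose U ** U = mat 1\<close> makes the residual orthogonal to it.\<close>

lemma orth_proj_matrix_orthonormal:
  fixes U :: "real^'r^'m"
  assumes S: "subspace S" "dim S = CARD('r)"
    and U: "columns U \<subseteq> S" "transpose U ** U = mat 1"
  shows "orth_proj_matrix S = U ** transpose U"
proof (rule orth_proj_matrix_unique[OF S(1)])
  show "\<forall>x. orth_proj_matrix S *v x \<in> S \<and> (\<forall>s\<in>S. orthogonal (x - orth_proj_matrix S *v x) s)"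
    using orth_proj_matrix_works[OF S(1)] by blast
  have range: "range ((*v) U) = S" using assms by (rule orthonormal_columns_range)
  have "orthogonal (x - (U ** transpose U) *v x) (U *v w)" for x w
  proof -
    have "(U *v w) \<bullet> (x - (U ** transpose U) *v x) = 0"
      by (simp add: inner_matrix_vector_transpose matrix_vector_mult_diff_distrib
          matrix_vector_mul_assoc matrix_mul_assoc U(2))
    then show ?thesis by (simp add: orthogonal_def inner_commute)
  qed
  moreover have "(U ** transpose U) *v x \<in> range ((*v) U)" for x
    by (simp flip: matrix_vector_mul_assoc)
  ultimately show "\<forall>x. (U ** transpose U) *v x \<in> S \<and>
      (\<forall>s\<in>S. orthogonal (x - (U ** transpose U) *v x) s)"
    using range by blast
qed

lemma orthonormal_columns_exist:
  fixes S :: "(real^'m) set"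
  assumes S: "subspace S" "dim S = CARD('r::finite)"
  obtains U :: "real^'r^'m" where "columns U \<subseteq> S" "transpose U ** U = mat 1"
proof -
  obtain B where B: "B \<subseteq> S" "pairwise orthogonal B" "\<And>x. x \<in> B \<Longrightarrow> norm x = 1"
    "independent B" "card B = dim S"
    by (rule orthonormal_basis_subspace[OF S(1)]) (rule that; simp)
  have "finite B" using B(4) independent_imp_finite by blast
  then obtain f where f: "bij_betw f (UNIV::'r set) B"
    using B(5) S(2) finite_same_card_bij[of "UNIV::'r set" B] by auto
  define U :: "real^'r^'m" where "U = (\<chi> i j. f j $ i)"
  have col: "column j U = f j" for j by (simp add: U_def column_def vec_eq_iff)
  have fB: "f j \<in> B" for j using f by (auto simp: bij_betw_def)
  have "columns U \<subseteq> S" using fB B(1) by (auto simp: columns_def col)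
  moreover have "f i \<bullet> f j = (if i = j then 1 else 0)" for i j
  proof (cases "i = j")
    case False
    then have "f i \<noteq> f j" using f by (metis UNIV_I bij_betw_imp_inj_on inj_onD)
    then show ?thesis using False fB B(2) by (simp add: pairwise_def orthogonal_def)
  qed (use fB B(3) in \<open>simp add: norm_eq_1[symmetric]\<close>)
  then have "transpose U ** U = mat 1"
    by (simp add: matrix_mult_transpose_dot_column col mat_def)
  ultimately show ?thesis by (rule that)
qed

section \<open>The objective in basis coordinates and its maximizers\<close>

lemma D_matrix_vector:
  "D_matrix U V As *v x = (\<chi> i. vectorize (transpose U ** As i ** V) \<bullet> x)"
  by (simp add: vec_eq_iff matrix_vector_mul_component D_matrix_def row_def)

lemma proj_mask_orthonormal_inner:
  fixes U :: "real^'r^'m1" and V :: "real^'r^'m2"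
  assumes "subspace \<U>" "dim \<U> = CARD('r)" "subspace \<V>" "dim \<V> = CARD('r)"
    and U: "columns U \<subseteq> \<U>" "transpose U ** U = mat 1"
    and V: "columns V \<subseteq> \<V>" "transpose V ** V = mat 1"
  shows "proj_mask \<U> \<V> A \<bullet> proj_mask \<U> \<V> B =
    vectorize (transpose U ** A ** V) \<bullet> vectorize (transpose U ** B ** V)"
proof -
  have "proj_mask \<U> \<V> C = U ** (transpose U ** C ** V) ** transpose V" for C
    using orth_proj_matrix_orthonormal[of \<U> U] orth_proj_matrix_orthonormal[of \<V> V] assms
    by (simp add: proj_mask_def matrix_mul_assoc)
  then show ?thesis
    by (simp only: inner_sandwich orthonormal_sandwich_cancel[OF U(2) V(2)] vectorize_inner)
qed

text \<open>Both sides are the Gram matrix of the compressed masks, which are the rows of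
  \<open>D_matrix U V As\<close>.\<close>

lemma R_hat_orthonormal:
  fixes U :: "real^'r^'m1" and V :: "real^'r^'m2"
  assumes "subspace \<U>" "dim \<U> = CARD('r)" "subspace \<V>" "dim \<V> = CARD('r)"
    and "columns U \<subseteq> \<U>" "transpose U ** U = mat 1"
    and "columns V \<subseteq> \<V>" "transpose V ** V = mat 1"
  shows "R_hat \<U> \<V> (As :: 'n::finite \<Rightarrow> _) = D_matrix U V As ** transpose (D_matrix U V As)"
proof -
  have "D ** transpose D = (\<chi> i j. D $ i \<bullet> D $ j)" for D :: "real^('r \<times> 'r)^'n"
    by (simp add: matrix_matrix_mult_def transpose_def inner_vec_def)
  then show ?thesis
    by (simp add: R_hat_def frob_inner_eq proj_mask_orthonormal_inner[OF assms] D_matrix_def)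
qed

lemma mask_objective_orthonormal:
  fixes U :: "real^'r^'m1" and V :: "real^'r^'m2"
    and As :: "'n::finite \<Rightarrow> real^'m2^'m1" and \<gamma> :: real
  assumes "subspace \<U>" "dim \<U> = CARD('r)" "subspace \<V>" "dim \<V> = CARD('r)"
    and "columns U \<subseteq> \<U>" "transpose U ** U = mat 1"
    and "columns V \<subseteq> \<V>" "transpose V ** V = mat 1"
  defines "M \<equiv> transpose (D_matrix U V As) ** matrix_inv (R_hat \<U> \<V> As + \<gamma>\<^sup>2 *\<^sub>R mat 1)
    ** D_matrix U V As"
  shows "mask_objective \<U> \<V> \<gamma> As A =
    vectorize (transpose U ** A ** V) \<bullet> vectorize (transpose U ** A ** V)
    - vectorize (transpose U ** A ** V) \<bullet> (M *v vectorize (transpose U ** A ** V))"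
proof -
  have "r_hat \<U> \<V> As A = D_matrix U V As *v vectorize (transpose U ** A ** V)"
    by (simp add: r_hat_def frob_inner_eq proj_mask_orthonormal_inner[OF assms(1-8)]
        D_matrix_vector)
  then show ?thesis
    unfolding mask_objective_def M_def ridge_quadratic_form
    by (simp add: frob_norm_eq power2_norm_eq_inner proj_mask_orthonormal_inner[OF assms(1-8)])
qed

text \<open>Both conclusions rest on one value: with \<open>\<mu>\<close> the least Rayleigh
  quotient of \<open>M\<close>, the maximum of the objective is \<open>1 - \<mu>\<close>, and it is
  attained.\<close>

lemma optimal_mask_iff_eigenvector:
  fixes U :: "real^'r^'m1" and V :: "real^'r^'m2"
    and As :: "'n::finite \<Rightarrow> real^'m2^'m1" and \<gamma> :: real
  assumes basis: "subspace \<U>" "dim \<U> = CARD('r)" "subspace \<V>" "dim \<V> = CARD('r)"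
    "columns U \<subseteq> \<U>" "transpose U ** U = mat 1"
    "columns V \<subseteq> \<V>" "transpose V ** V = mat 1"
    and \<gamma>: "\<gamma>\<^sup>2 > 0"
  defines "M \<equiv> transpose (D_matrix U V As) ** matrix_inv (R_hat \<U> \<V> As + \<gamma>\<^sup>2 *\<^sub>R mat 1)
    ** D_matrix U V As"
  shows "optimal_mask \<U> \<V> \<gamma> As A \<longleftrightarrow>
    (\<exists>\<Sigma> l. A = U ** \<Sigma> ** transpose V \<and> norm (vectorize \<Sigma>) = 1 \<and>
      smallest_eigenvalue M l \<and> eigenvector M (vectorize \<Sigma>) l)"
    and "\<exists>A. optimal_mask \<U> \<V> \<gamma> As A"
proof -
  define X where "X A = transpose U ** A ** V" for A
  define d where "d A = vectorize (X A)" for A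
  define f where "f A = mask_objective \<U> \<V> \<gamma> As A" for A
  have M: "M = transpose (D_matrix U V As) ** matrix_inv (D_matrix U V As **
      transpose (D_matrix U V As) + \<gamma>\<^sup>2 *\<^sub>R mat 1) ** D_matrix U V As"
    unfolding M_def R_hat_orthonormal[OF basis] ..
  have sym: "transpose M = M" unfolding M by (rule ridge_matrix_symmetric[OF \<gamma>])
  have less: "x \<bullet> (M *v x) < x \<bullet> x" if "x \<noteq> 0" for x
    unfolding M using \<gamma> that by (rule ridge_quadratic_form_less)
  have f: "f A = (norm (d A))\<^sup>2 - d A \<bullet> (M *v d A)" for A
    unfolding f_def d_def X_def M_def power2_norm_eq_inner
    by (rule mask_objective_orthonormal[OF basis])
  have pyth: "(norm A)\<^sup>2 = (norm (d A))\<^sup>2 + (norm (A - U ** X A ** transpose V))\<^sup>2" for A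
    unfolding d_def X_def norm_vectorize by (rule norm_orthonormal_compression[OF basis(6,8)])
  have XU: "X (U ** \<Sigma> ** transpose V) = \<Sigma>" for \<Sigma>
    unfolding X_def by (rule orthonormal_sandwich_cancel[OF basis(6,8)])
  have nU: "norm (U ** \<Sigma> ** transpose V) = norm (vectorize \<Sigma>)" for \<Sigma>
    using pyth[of "U ** \<Sigma> ** transpose V"] by (simp add: XU d_def)
  obtain v where v: "norm v = 1" "\<And>x. (v \<bullet> (M *v v)) * (x \<bullet> x) \<le> x \<bullet> (M *v x)"
    using rayleigh_minimizer_exists by blast
  define \<mu> where "\<mu> = v \<bullet> (M *v v)"
  \<comment> \<open>Positive noise enters here: \<open>1 - \<mu>\<close> is strictly positive, so
    any loss in \<open>norm (d A)\<close> costs objective value.\<close>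
  have \<mu>: "\<mu> < 1" using less[of v] v(1) by (metis \<mu>_def norm_eq_1 norm_zero zero_neq_one)
  have bound: "f A \<le> (1 - \<mu>) * (norm (d A))\<^sup>2" for A
    using v(2)[of "d A"] by (simp add: f \<mu>_def power2_norm_eq_inner algebra_simps)
  \<comment> \<open>Lifting the Rayleigh minimizer back to a mask gives a feasible point that
    attains the upper bound.\<close>
  obtain S where S: "vectorize S = v" using vectorize_surj by blast
  have best: "norm (U ** S ** transpose V) = 1" "f (U ** S ** transpose V) = 1 - \<mu>"
    using v(1) by (simp_all add: nU S f d_def XU \<mu>_def)
  have opt: "optimal_mask \<U> \<V> \<gamma> As A \<longleftrightarrow> norm A \<le> 1 \<and> f A = 1 - \<mu>" for A
  proof -
    have "f B \<le> 1 - \<mu>" if "norm B \<le> 1" for B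
    proof -
      have "(norm (d B))\<^sup>2 \<le> (norm B)\<^sup>2" using pyth[of B] by simp
      also have "\<dots> \<le> 1" using that by (simp add: power_le_one)
      finally show ?thesis using bound[of B] \<mu>
        by (smt (verit) mult_left_le)
    qed
    moreover have "(norm B)\<^sup>2 \<le> 1 \<longleftrightarrow> norm B \<le> 1" for B :: "real^'m2^'m1"
      by (simp add: power_le_one_iff)
    ultimately show ?thesis
      using best unfolding optimal_mask_def is_arg_max_def frob_norm_eq f_def[symmetric]
      by (smt (verit))
  qed
  show "\<exists>A. optimal_mask \<U> \<V> \<gamma> As A" using best opt by (metis order_refl)
  \<comment> \<open>Comparing the lower bounds at the two unit vectors \<open>x\<close> and
    \<open>v\<close> pins \<open>l\<close> to \<open>\<mu>\<close>.\<close>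
  have eig: "smallest_eigenvalue M l \<and> eigenvector M x l \<longleftrightarrow> l = \<mu> \<and> x \<bullet> (M *v x) = \<mu>"
    if "norm x = 1" for x l
  proof -
    have "x \<bullet> x = 1" "v \<bullet> v = 1" using that v(1) by (auto simp: norm_eq_1)
    then have "\<mu> = l" if "x \<bullet> (M *v x) = l" "\<forall>y. l * (y \<bullet> y) \<le> y \<bullet> (M *v y)"
      using that v(2)[of x] by (metis \<mu>_def mult.right_neutral order_antisym)
    then show ?thesis
      using smallest_eigenvalue_rayleigh[OF sym that, of l] v(2) by (auto simp: \<mu>_def)
  qed
  show "optimal_mask \<U> \<V> \<gamma> As A \<longleftrightarrow>
    (\<exists>\<Sigma> l. A = U ** \<Sigma> ** transpose V \<and> norm (vectorize \<Sigma>) = 1 \<and>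
      smallest_eigenvalue M l \<and> eigenvector M (vectorize \<Sigma>) l)"
  proof
    assume "optimal_mask \<U> \<V> \<gamma> As A"
    then have A: "norm A \<le> 1" "f A = 1 - \<mu>" using opt by auto
    have "(1 - \<mu>) * 1 \<le> (1 - \<mu>) * (norm (d A))\<^sup>2" using bound[of A] A by simp
    then have "1 \<le> (norm (d A))\<^sup>2" using \<mu> by (simp only: mult_le_cancel_left)
    moreover have "(norm A)\<^sup>2 \<le> 1" using A by (simp add: power_le_one)
    \<comment> \<open>Pythagoras squeezes: \<open>(norm (d A))\<^sup>2\<close> is at least 1, and
      adding the squared residual gives at most 1, so the residual vanishes.\<close>
    ultimately have n: "(norm (d A))\<^sup>2 = 1" "(norm (A - U ** X A ** transpose V))\<^sup>2 = 0"
      using pyth[of A] zero_le_power2[of "norm (A - U ** X A ** transpose V)"] by linarith+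
    have n1: "norm (d A) = 1" using n(1) power2_eq_iff_nonneg[of "norm (d A)" 1] by simp
    have AX: "A = U ** X A ** transpose V"
      using n(2) by (metis norm_eq_zero power_eq_0_iff right_minus_eq)
    have "d A \<bullet> (M *v d A) = \<mu>" using f[of A] A(2) n(1) by linarith
    then have E: "smallest_eigenvalue M \<mu>" "eigenvector M (vectorize (X A)) \<mu>"
      using eig[OF n1, of \<mu>] unfolding d_def by blast+
    show "\<exists>\<Sigma> l. A = U ** \<Sigma> ** transpose V \<and> norm (vectorize \<Sigma>) = 1 \<and>
      smallest_eigenvalue M l \<and> eigenvector M (vectorize \<Sigma>) l"
      by (intro exI conjI) (rule AX, rule n1[unfolded d_def], rule E, rule E)
  next
    assume "\<exists>\<Sigma> l. A = U ** \<Sigma> ** transpose V \<and> norm (vectorize \<Sigma>) = 1 \<and>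
      smallest_eigenvalue M l \<and> eigenvector M (vectorize \<Sigma>) l"
    then obtain \<Sigma> l where \<Sigma>: "A = U ** \<Sigma> ** transpose V" "norm (vectorize \<Sigma>) = 1"
      "smallest_eigenvalue M l \<and> eigenvector M (vectorize \<Sigma>) l"
      by blast
    from \<Sigma>(3) have "vectorize \<Sigma> \<bullet> (M *v vectorize \<Sigma>) = \<mu>"
      unfolding eig[OF \<Sigma>(2)] ..
    with \<Sigma>(1,2) show "optimal_mask \<U> \<V> \<gamma> As A"
      by (simp add: opt nU f d_def XU)
  qed
qed

theorem theorem8:
  fixes \<U> :: "(real^'m1) set" and \<V> :: "(real^'m2) set"
    and As :: "'n::finite \<Rightarrow> real^'m2^'m1"
    and \<gamma> \<eta> \<sigma> :: real
  assumes rank: "CARD('r::finite) < min CARD('m1) CARD('m2)"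
    and "subspace \<U>" and "dim \<U> = CARD('r)"
    and "subspace \<V>" and "dim \<V> = CARD('r)"
    and power: "\<And>i. (frob_norm (As i))\<^sup>2 \<le> 1"
    and "\<sigma> > 0" and "\<eta> > 0" and "\<gamma>\<^sup>2 = \<eta>\<^sup>2 / \<sigma>\<^sup>2"
  shows "(\<exists>A. optimal_mask \<U> \<V> \<gamma> As A) \<and>
    (\<forall>(U :: real^'r^'m1) (V :: real^'r^'m2).
      columns U \<subseteq> \<U> \<and> transpose U ** U = mat 1 \<and>
      columns V \<subseteq> \<V> \<and> transpose V ** V = mat 1 \<longrightarrow>
      (\<forall>A. optimal_mask \<U> \<V> \<gamma> As A \<longleftrightarrow>
        (\<exists>(\<Sigma> :: real^'r^'r) l.
          A = U ** \<Sigma> ** transpose V \<and>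
          norm (vectorize \<Sigma>) = 1 \<and>
          (let M = transpose (D_matrix U V As)
                     ** matrix_inv (R_hat \<U> \<V> As + \<gamma>\<^sup>2 *\<^sub>R mat 1)
                     ** D_matrix U V As
           in smallest_eigenvalue M l \<and> eigenvector M (vectorize \<Sigma>) l))))"
proof -
  have \<gamma>: "\<gamma>\<^sup>2 > 0" using assms by simp
  \<comment> \<open>Existence of a maximizer does not mention bases, so one pair is chosen for it;
    the equivalence is then proved for every pair.\<close>
  obtain U :: "real^'r^'m1" and V :: "real^'r^'m2" where
    "columns U \<subseteq> \<U>" "transpose U ** U = mat 1" "columns V \<subseteq> \<V>" "transpose V ** V = mat 1"
    using orthonormal_columns_exist assms(2-5) by metis
  from optimal_mask_iff_eigenvector(2)[OF assms(2-5) this \<gamma>]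
  have "\<exists>A. optimal_mask \<U> \<V> \<gamma> As A" .
  then show ?thesis
    unfolding Let_def using optimal_mask_iff_eigenvector(1)[OF assms(2-5) _ _ _ _ \<gamma>] by blast
qed

end
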